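(* Let $D$ be a small category. For each functor $X:D\to\mathbf{S}$ to simplicial sets there is an isomorphism $$\int^{d\in D}X(d)\ \cong\ N_X(D)$$ in the category $\mathbf{S}/N(D)$ of simplicial sets over the nerve $N(D)$.
   Context: $\mathbf{S}$ is the category of simplicial sets; $[n]$ is the category $0\to1\to\cdots\to n$. The simplicial set $\int^{d\in D}X(d)$: let $c(n):[n]\to\mathbf{S}$ be the functor $\Delta[0]\xrightarrow{d_1}\Delta[1]\xrightarrow{d_2}\cdots\xrightarrow{d_n}\Delta[n]$, where $d_i:\Delta[i-1]\to\Delta[i]$ is the inclusion of the face opposite the last vertex $i$. An $n$-simplex of $\int^{d\in D}X(d)$ is a pair $(\sigma,\beta)$, where $\sigma\in N(D)_n$ is a functor $\sigma:[n]\to D$ and $\beta:c(n)\Rightarrow X\circ\sigma$ is a natural transformation; equivalently $\beta$ is a tuple $(\beta_0,\dots,\beta_n)$ with $\beta_i\in X(\sigma(i))_i$ and $X(\sigma(i-1\to i))(\beta_{i-1})=d_i(\beta_i)$ for $1\le i\le n$. Faces and degeneracies are those of $N(D)$ on $\sigma$ and on tuples $d_i(\beta)=(\beta_0,\dots,\beta_{i-1},d_i\beta_{i+1},\dots,d_i\beta_n)$, $s_i(\beta)=(\beta_0,\dots,\beta_i,s_i\beta_i,s_i\beta_{i+1},\dots,s_i\beta_n)$. The map to $N(D)$ is $(\sigma,\beta)\mapsto\sigma$. The relative nerve $N_X(D)$: an $n$-simplex consists of (i) a functor $d:[n]\to D$; (ii) for every nonempty subposet $K\subseteq[n]$ with maximal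 element $k$, a map $\tau^K:\Delta^K\to X(d(k))$; such that (iii) for nonempty $I\subseteq K\subseteq[n]$ with maximal elements $i\le k$, the restriction of $\tau^K$ to $\Delta^I$ equals $X(d(i\to k))\circ\tau^I$. Simplicial structure is given by restriction along maps of $\Delta$, and the map to $N(D)$ is $(d,\tau)\mapsto d$. *)

theory Defs
  imports "HOL-Library.FuncSet"
begin

text \<open>
  Conventions.  Every function that is itself a mathematical object (a component of a functor,
  a level of a simplicial map, a monotone map, a family indexed by a set) is extensional, that is,
  equal to \<open>undefined\<close> outside its domain, so that HOL equality is equality of such objects.
  Structure maps of records are only constrained on their carriers.  Smallness of a category is
  automatic, since objects and arrows form sets.
\<close>

section \<open>Categories and functors\<close>

record ('o, 'm) cat =
  Ob :: "'o set"
  Ar :: "'m set"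
  Dom :: "'m \<Rightarrow> 'o"
  Cod :: "'m \<Rightarrow> 'o"
  Idt :: "'o \<Rightarrow> 'm"
  Comp :: "'m \<Rightarrow> 'm \<Rightarrow> 'm"  \<comment> \<open>\<open>Comp C g f\<close> is \<open>g\<close> after \<open>f\<close>\<close>

locale category =
  fixes C :: "('o, 'm) cat"
  assumes Dom_in: "f \<in> Ar C \<Longrightarrow> Dom C f \<in> Ob C"
    and Cod_in: "f \<in> Ar C \<Longrightarrow> Cod C f \<in> Ob C"
    and Idt_in: "a \<in> Ob C \<Longrightarrow> Idt C a \<in> Ar C"
    and Dom_Idt: "a \<in> Ob C \<Longrightarrow> Dom C (Idt C a) = a"
    and Cod_Idt: "a \<in> Ob C \<Longrightarrow> Cod C (Idt C a) = a"
    and Comp_in: "\<lbrakk>f \<in> Ar C; g \<in> Ar C; Cod C f = Dom C g\<rbrakk> \<Longrightarrow> Comp C g f \<in> Ar C"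
    and Dom_Comp: "\<lbrakk>f \<in> Ar C; g \<in> Ar C; Cod C f = Dom C g\<rbrakk> \<Longrightarrow> Dom C (Comp C g f) = Dom C f"
    and Cod_Comp: "\<lbrakk>f \<in> Ar C; g \<in> Ar C; Cod C f = Dom C g\<rbrakk> \<Longrightarrow> Cod C (Comp C g f) = Cod C g"
    and Comp_Idt: "f \<in> Ar C \<Longrightarrow> Comp C f (Idt C (Dom C f)) = f"
    and Idt_Comp: "f \<in> Ar C \<Longrightarrow> Comp C (Idt C (Cod C f)) f = f"
    and Comp_assoc: "\<lbrakk>f \<in> Ar C; g \<in> Ar C; h \<in> Ar C; Cod C f = Dom C g; Cod C g = Dom C h\<rbrakk>
      \<Longrightarrow> Comp C h (Comp C g f) = Comp C (Comp C h g) f"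

record ('o, 'm, 'p, 'q) funct =
  FOb :: "'o \<Rightarrow> 'p"
  FAr :: "'m \<Rightarrow> 'q"

definition is_functor :: "('o, 'm) cat \<Rightarrow> ('p, 'q) cat \<Rightarrow> ('o, 'm, 'p, 'q) funct \<Rightarrow> bool" where
  "is_functor C D F \<longleftrightarrow>
    FOb F \<in> Ob C \<rightarrow>\<^sub>E Ob D \<and> FAr F \<in> Ar C \<rightarrow>\<^sub>E Ar D \<and>
    (\<forall>f\<in>Ar C. Dom D (FAr F f) = FOb F (Dom C f) \<and> Cod D (FAr F f) = FOb F (Cod C f)) \<and>
    (\<forall>a\<in>Ob C. FAr F (Idt C a) = Idt D (FOb F a)) \<and>
    (\<forall>f\<in>Ar C. \<forall>g\<in>Ar C. Cod C f = Dom C g \<longrightarrow> FAr F (Comp C g f) = Comp D (FAr F g) (FAr F f))"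

definition functor_comp ::
  "('o, 'm) cat \<Rightarrow> ('p, 'q, 'r, 's) funct \<Rightarrow> ('o, 'm, 'p, 'q) funct \<Rightarrow> ('o, 'm, 'r, 's) funct" where
  "functor_comp C G F = \<lparr>FOb = compose (Ob C) (FOb G) (FOb F), FAr = compose (Ar C) (FAr G) (FAr F)\<rparr>"

text \<open>The category \<open>[n]\<close>; the unique arrow \<open>i \<rightarrow> j\<close> is the pair \<open>(i, j)\<close>.\<close>

definition ordinal :: "nat \<Rightarrow> (nat, nat \<times> nat) cat" where
  "ordinal n = \<lparr>Ob = {..n}, Ar = {(i, j). i \<le> j \<and> j \<le> n}, Dom = fst, Cod = snd,
     Idt = (\<lambda>i. (i, i)), Comp = (\<lambda>g f. (fst f, snd g))\<rparr>"

definition delta_hom :: "nat \<Rightarrow> nat \<Rightarrow> (nat \<Rightarrow> nat) set" where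
  "delta_hom m n = {\<theta> \<in> {..m} \<rightarrow>\<^sub>E {..n}. mono_on {..m} \<theta>}"

definition ordinal_map :: "nat \<Rightarrow> (nat \<Rightarrow> nat) \<Rightarrow> (nat, nat \<times> nat, nat, nat \<times> nat) funct" where
  "ordinal_map m \<theta> = \<lparr>FOb = restrict \<theta> (Ob (ordinal m)),
     FAr = (\<lambda>(i, j)\<in>Ar (ordinal m). (\<theta> i, \<theta> j))\<rparr>"

section \<open>Simplicial sets\<close>

text \<open>
  Functors from the opposite of the category of the \<open>[n]\<close> to sets: for \<open>\<theta> : [m] \<rightarrow> [n]\<close>,
  \<open>Act A m n \<theta>\<close> is the map from \<open>n\<close>-simplices to \<open>m\<close>-simplices.
\<close>

record 'x sset =
  Simp :: "nat \<Rightarrow> 'x set"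
  Act :: "nat \<Rightarrow> nat \<Rightarrow> (nat \<Rightarrow> nat) \<Rightarrow> 'x \<Rightarrow> 'x"

locale simplicial_set =
  fixes A :: "'x sset"
  assumes Act_in: "\<lbrakk>\<theta> \<in> delta_hom m n; x \<in> Simp A n\<rbrakk> \<Longrightarrow> Act A m n \<theta> x \<in> Simp A m"
    and Act_id: "x \<in> Simp A n \<Longrightarrow> Act A n n (\<lambda>i\<in>{..n}. i) x = x"
    and Act_comp: "\<lbrakk>\<phi> \<in> delta_hom k m; \<theta> \<in> delta_hom m n; x \<in> Simp A n\<rbrakk>
      \<Longrightarrow> Act A k n (compose {..k} \<theta> \<phi>) x = Act A k m \<phi> (Act A m n \<theta> x)"

type_synonym ('x, 'y) smap = "nat \<Rightarrow> 'x \<Rightarrow> 'y"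

definition sset_map :: "'x sset \<Rightarrow> 'y sset \<Rightarrow> ('x, 'y) smap \<Rightarrow> bool" where
  "sset_map A B f \<longleftrightarrow>
    (\<forall>n. f n \<in> Simp A n \<rightarrow>\<^sub>E Simp B n) \<and>
    (\<forall>m n. \<forall>\<theta>\<in>delta_hom m n. \<forall>x\<in>Simp A n. f m (Act A m n \<theta> x) = Act B m n \<theta> (f n x))"

definition smap_id :: "'x sset \<Rightarrow> ('x, 'x) smap" where
  "smap_id A = (\<lambda>n. \<lambda>x\<in>Simp A n. x)"

definition smap_comp :: "'x sset \<Rightarrow> ('y, 'z) smap \<Rightarrow> ('x, 'y) smap \<Rightarrow> ('x, 'z) smap" where
  "smap_comp A g f = (\<lambda>n. compose (Simp A n) (g n) (f n))"

text \<open>Isomorphism in the category of simplicial sets over \<open>B\<close>, of \<open>p : A \<rightarrow> B\<close> and \<open>q : A' \<rightarrow> B\<close>.\<close>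

definition over :: "'b sset \<Rightarrow> 'x sset \<Rightarrow> ('x, 'b) smap \<Rightarrow> bool" where
  "over B A p \<longleftrightarrow> simplicial_set B \<and> simplicial_set A \<and> sset_map A B p"

definition over_map ::
  "'x sset \<Rightarrow> ('x, 'b) smap \<Rightarrow> 'y sset \<Rightarrow> ('y, 'b) smap \<Rightarrow> ('x, 'y) smap \<Rightarrow> bool" where
  "over_map A p A' q f \<longleftrightarrow> sset_map A A' f \<and> smap_comp A q f = p"

definition iso_over ::
  "'b sset \<Rightarrow> 'x sset \<Rightarrow> ('x, 'b) smap \<Rightarrow> 'y sset \<Rightarrow> ('y, 'b) smap \<Rightarrow> bool" where
  "iso_over B A p A' q \<longleftrightarrow> over B A p \<and> over B A' q \<and>
    (\<exists>f g. over_map A p A' q f \<and> over_map A' q A p g \<and>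
       smap_comp A g f = smap_id A \<and> smap_comp A' f g = smap_id A')"

section \<open>Functors to simplicial sets\<close>

record ('o, 'm, 'x) sset_diagram =
  DOb :: "'o \<Rightarrow> 'x sset"
  DAr :: "'m \<Rightarrow> ('x, 'x) smap"

definition sset_functor :: "('o, 'm) cat \<Rightarrow> ('o, 'm, 'x) sset_diagram \<Rightarrow> bool" where
  "sset_functor C X \<longleftrightarrow>
    (\<forall>a\<in>Ob C. simplicial_set (DOb X a)) \<and>
    (\<forall>f\<in>Ar C. sset_map (DOb X (Dom C f)) (DOb X (Cod C f)) (DAr X f)) \<and>
    (\<forall>a\<in>Ob C. DAr X (Idt C a) = smap_id (DOb X a)) \<and>
    (\<forall>f\<in>Ar C. \<forall>g\<in>Ar C. Cod C f = Dom C g \<longrightarrow>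
       DAr X (Comp C g f) = smap_comp (DOb X (Dom C f)) (DAr X g) (DAr X f))"

definition diagram_comp ::
  "('p, 'q, 'x) sset_diagram \<Rightarrow> ('o, 'm, 'p, 'q) funct \<Rightarrow> ('o, 'm, 'x) sset_diagram" where
  "diagram_comp X F = \<lparr>DOb = (\<lambda>a. DOb X (FOb F a)), DAr = (\<lambda>f. DAr X (FAr F f))\<rparr>"

definition sset_nat_trans ::
  "('o, 'm) cat \<Rightarrow> ('o, 'm, 'x) sset_diagram \<Rightarrow> ('o, 'm, 'y) sset_diagram
    \<Rightarrow> ('o \<Rightarrow> ('x, 'y) smap) \<Rightarrow> bool" where
  "sset_nat_trans C X Y \<beta> \<longleftrightarrow>
    \<beta> \<in> extensional (Ob C) \<and> (\<forall>a\<in>Ob C. sset_map (DOb X a) (DOb Y a) (\<beta> a)) \<and>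
    (\<forall>f\<in>Ar C. smap_comp (DOb X (Dom C f)) (\<beta> (Cod C f)) (DAr X f)
            = smap_comp (DOb X (Dom C f)) (DAr Y f) (\<beta> (Dom C f)))"

section \<open>Simplices and the nerve\<close>

text \<open>\<open>simplex K\<close> is \<open>\<Delta>\<^sup>K\<close> for a subposet \<open>K\<close> of the natural numbers; \<open>\<Delta>[n]\<close> is \<open>simplex {..n}\<close>.\<close>

definition simplex :: "nat set \<Rightarrow> (nat \<Rightarrow> nat) sset" where
  "simplex K = \<lparr>Simp = (\<lambda>m. {f \<in> {..m} \<rightarrow>\<^sub>E K. mono_on {..m} f}),
     Act = (\<lambda>m n \<theta> f. compose {..m} f \<theta>)\<rparr>"

text \<open>The map \<open>\<Delta>\<^sup>K \<rightarrow> \<Delta>\<^sup>L\<close> induced by a map \<open>\<theta> : K \<rightarrow> L\<close> that is monotone on \<open>K\<close>.\<close>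

definition simplex_map :: "nat set \<Rightarrow> (nat \<Rightarrow> nat) \<Rightarrow> (nat \<Rightarrow> nat, nat \<Rightarrow> nat) smap" where
  "simplex_map K \<theta> = (\<lambda>m. \<lambda>f\<in>Simp (simplex K) m. compose {..m} \<theta> f)"

abbreviation simplex_incl :: "nat set \<Rightarrow> (nat \<Rightarrow> nat, nat \<Rightarrow> nat) smap" where
  "simplex_incl I \<equiv> simplex_map I (\<lambda>i. i)"

definition nerve :: "('o, 'm) cat \<Rightarrow> (nat, nat \<times> nat, 'o, 'm) funct sset" where
  "nerve D = \<lparr>Simp = (\<lambda>n. {\<sigma>. is_functor (ordinal n) D \<sigma>}),
     Act = (\<lambda>m n \<theta> \<sigma>. functor_comp (ordinal m) \<sigma> (ordinal_map m \<theta>))\<rparr>"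

section \<open>The simplicial set of pairs \<open>(\<sigma>, \<beta>)\<close>\<close>

text \<open>
  The functor \<open>c(n)\<close> from \<open>[n]\<close>.  The face of \<open>\<Delta>[i]\<close> opposite the last vertex is the image of the
  inclusion of \<open>\<Delta>[i - 1]\<close>, so \<open>i \<rightarrow> j\<close> goes to the inclusion of \<open>\<Delta>[i]\<close> into \<open>\<Delta>[j]\<close>.
  The formula does not involve \<open>n\<close>; \<open>c(n)\<close> is its restriction to \<open>ordinal n\<close>.
\<close>

definition last_faces :: "(nat, nat \<times> nat, nat \<Rightarrow> nat) sset_diagram" where
  "last_faces = \<lparr>DOb = (\<lambda>i. simplex {..i}), DAr = (\<lambda>(i, j). simplex_incl {..i})\<rparr>"

text \<open>
  A map \<open>\<theta> : [m] \<rightarrow> [n]\<close> restricts to maps \<open>[j] \<rightarrow> [\<theta> j]\<close>, hence gives a natural transformation from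
  \<open>c(m)\<close> to \<open>c(n) \<circ> \<theta>\<close>.  It acts on \<open>\<beta>\<close> by composition with this transformation.  The lemmas
  \<open>tuple_face\<close> and \<open>tuple_degeneracy\<close> below give the resulting faces and degeneracies in terms of
  tuples, and \<open>tuple_bij\<close> identifies natural transformations with tuples.
\<close>

definition integral ::
  "('o, 'm) cat \<Rightarrow> ('o, 'm, 'x) sset_diagram
    \<Rightarrow> ((nat, nat \<times> nat, 'o, 'm) funct \<times> (nat \<Rightarrow> (nat \<Rightarrow> nat, 'x) smap)) sset" where
  "integral D X = \<lparr>
     Simp = (\<lambda>n. {(\<sigma>, \<beta>). \<sigma> \<in> Simp (nerve D) n \<and>
               sset_nat_trans (ordinal n) last_faces (diagram_comp X \<sigma>) \<beta>}),
     Act = (\<lambda>m n \<theta> (\<sigma>, \<beta>). (Act (nerve D) m n \<theta> \<sigma>,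
               \<lambda>j\<in>{..m}. smap_comp (simplex {..j}) (\<beta> (\<theta> j)) (simplex_map {..j} \<theta>)))\<rparr>"

definition integral_proj ::
  "('o, 'm) cat \<Rightarrow> ('o, 'm, 'x) sset_diagram
    \<Rightarrow> ((nat, nat \<times> nat, 'o, 'm) funct \<times> (nat \<Rightarrow> (nat \<Rightarrow> nat, 'x) smap),
        (nat, nat \<times> nat, 'o, 'm) funct) smap" where
  "integral_proj D X = (\<lambda>n. \<lambda>s\<in>Simp (integral D X) n. fst s)"

section \<open>The relative nerve\<close>

text \<open>
  For \<open>\<theta> : [m] \<rightarrow> [n]\<close> and \<open>K \<subseteq> [m]\<close>, the \<open>K\<close>-component of the restriction of \<open>\<tau>\<close> along \<open>\<theta>\<close> is
  the composite of \<open>\<Delta>\<^sup>K \<rightarrow> \<Delta>\<^bsup>\<theta>(K)\<^esup>\<close> with the \<open>\<theta>(K)\<close>-component of \<open>\<tau>\<close>;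
  note that \<open>\<theta>\<close> sends the maximum of \<open>K\<close> to that of \<open>\<theta>(K)\<close>.
\<close>

definition subposets :: "nat \<Rightarrow> nat set set" where
  "subposets n = {K. K \<noteq> {} \<and> K \<subseteq> {..n}}"

definition rel_nerve ::
  "('o, 'm) cat \<Rightarrow> ('o, 'm, 'x) sset_diagram
    \<Rightarrow> ((nat, nat \<times> nat, 'o, 'm) funct \<times> (nat set \<Rightarrow> (nat \<Rightarrow> nat, 'x) smap)) sset" where
  "rel_nerve D X = \<lparr>
     Simp = (\<lambda>n. {(d, \<tau>). is_functor (ordinal n) D d \<and> \<tau> \<in> extensional (subposets n) \<and>
        (\<forall>K\<in>subposets n. sset_map (simplex K) (DOb X (FOb d (Max K))) (\<tau> K)) \<and>
        (\<forall>K\<in>subposets n. \<forall>I\<in>subposets n. I \<subseteq> K \<longrightarrow>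
           smap_comp (simplex I) (\<tau> K) (simplex_incl I) =
           smap_comp (simplex I) (DAr X (FAr d (Max I, Max K))) (\<tau> I))}),
     Act = (\<lambda>m n \<theta> (d, \<tau>). (Act (nerve D) m n \<theta> d,
        \<lambda>K\<in>subposets m. smap_comp (simplex K) (\<tau> (\<theta> ` K)) (simplex_map K \<theta>)))\<rparr>"

definition rel_nerve_proj ::
  "('o, 'm) cat \<Rightarrow> ('o, 'm, 'x) sset_diagram
    \<Rightarrow> ((nat, nat \<times> nat, 'o, 'm) funct \<times> (nat set \<Rightarrow> (nat \<Rightarrow> nat, 'x) smap),
        (nat, nat \<times> nat, 'o, 'm) funct) smap" where
  "rel_nerve_proj D X = (\<lambda>n. \<lambda>s\<in>Simp (rel_nerve D X) n. fst s)"

section \<open>Description by tuples\<close>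

definition coface :: "nat \<Rightarrow> nat \<Rightarrow> nat \<Rightarrow> nat" where
  "coface n i = (\<lambda>j\<in>{..n}. if j < i then j else Suc j)"

definition codegeneracy :: "nat \<Rightarrow> nat \<Rightarrow> nat \<Rightarrow> nat" where
  "codegeneracy n i = (\<lambda>j\<in>{..Suc n}. if j \<le> i then j else j - 1)"

definition tuple :: "nat \<Rightarrow> (nat \<Rightarrow> (nat \<Rightarrow> nat, 'x) smap) \<Rightarrow> nat \<Rightarrow> 'x" where
  "tuple n \<beta> = (\<lambda>i\<in>{..n}. \<beta> i i (\<lambda>j\<in>{..i}. j))"

definition tuples ::
  "('o, 'm, 'x) sset_diagram \<Rightarrow> nat \<Rightarrow> (nat, nat \<times> nat, 'o, 'm) funct \<Rightarrow> (nat \<Rightarrow> 'x) set" where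
  "tuples X n \<sigma> = {b \<in> (\<Pi>\<^sub>E i\<in>{..n}. Simp (DOb X (FOb \<sigma> i)) i).
     \<forall>i\<in>{1..n}. DAr X (FAr \<sigma> (i - 1, i)) (i - 1) (b (i - 1)) =
       Act (DOb X (FOb \<sigma> i)) (i - 1) i (coface (i - 1) i) (b i)}"

lemma coface_in: "coface n i \<in> delta_hom n (Suc n)"
  by (auto simp: coface_def delta_hom_def mono_on_def)

lemma codegeneracy_in: "codegeneracy n i \<in> delta_hom (Suc n) n" if "i \<le> n"
  using that by (auto simp: codegeneracy_def delta_hom_def mono_on_def)

lemma Simp_simplex: "Simp (simplex {..n}) m = delta_hom m n"
  by (simp add: simplex_def delta_hom_def)

lemma id_in_delta: "i \<le> j \<Longrightarrow> (\<lambda>x\<in>{..i}. x) \<in> delta_hom i j"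
  by (auto simp: delta_hom_def mono_on_def)

lemma last_faces_functor: "sset_functor (ordinal n) last_faces"
proof -
  have c: "compose {..m} (\<lambda>x. x) f = f" if "f \<in> {..m} \<rightarrow>\<^sub>E K" for f :: "nat \<Rightarrow> nat" and m and K :: "nat set"
    using that by (auto simp: compose_def PiE_def extensional_def fun_eq_iff)
  have S: "simplicial_set (simplex {..i})" for i
    by unfold_locales
      (auto simp: simplex_def delta_hom_def compose_def mono_on_def PiE_def Pi_def extensional_def fun_eq_iff)
  have I: "simplex_incl {..i} = (\<lambda>m. \<lambda>f\<in>delta_hom m i. f)" for i
    unfolding simplex_map_def Simp_simplex
    by (intro ext restrict_ext) (auto simp: delta_hom_def c)
  have le: "f \<in> delta_hom m j" if "f \<in> delta_hom m i" "i \<le> j" for f m i j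
    using that by (auto simp: delta_hom_def PiE_iff intro: order_trans)
  have comp_in: "compose {..m} f \<theta> \<in> delta_hom m i"
    if "\<theta> \<in> delta_hom m k" "f \<in> delta_hom k i" for f \<theta> m k i
    using that by (auto simp: delta_hom_def compose_def mono_on_def PiE_def Pi_def)
  have M: "sset_map (simplex {..i}) (simplex {..j}) (simplex_incl {..i})" if "i \<le> j" for i j
    unfolding sset_map_def I Simp_simplex using that
    by (auto simp: simplex_def comp_in intro: le)
  have C: "simplex_incl {..i} = smap_comp (simplex {..i}) (simplex_incl {..j}) (simplex_incl {..i})"
    if "i \<le> j" for i j
    unfolding smap_comp_def I Simp_simplex using that by (auto simp: fun_eq_iff compose_def le)
  show ?thesis
    using S M C unfolding sset_functor_def
    by (auto simp: ordinal_def last_faces_def smap_id_def I Simp_simplex)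
qed

lemma nat_trans_component:
  assumes "sset_nat_trans (ordinal n) last_faces (diagram_comp X \<sigma>) \<beta>" "i \<le> n"
  shows "sset_map (simplex {..i}) (DOb X (FOb \<sigma> i)) (\<beta> i)"
  using assms by (simp add: sset_nat_trans_def ordinal_def last_faces_def diagram_comp_def)

lemma nat_trans_eval:
  assumes "sset_nat_trans (ordinal n) last_faces (diagram_comp X \<sigma>) \<beta>" "i \<le> n"
    and f: "f \<in> delta_hom m i"
  shows "\<beta> i m f = Act (DOb X (FOb \<sigma> i)) m i f (tuple n \<beta> i)"
proof -
  have "compose {..m} (\<lambda>j\<in>{..i}. j) f = f"
    using f by (auto simp: delta_hom_def compose_def PiE_def extensional_def fun_eq_iff Pi_def)
  then have "Act (simplex {..i}) m i f (\<lambda>j\<in>{..i}. j) = f"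
    by (simp add: simplex_def)
  moreover have "\<forall>\<theta>\<in>delta_hom m i. \<forall>x\<in>delta_hom i i.
      \<beta> i m (Act (simplex {..i}) m i \<theta> x) = Act (DOb X (FOb \<sigma> i)) m i \<theta> (\<beta> i i x)"
    using nat_trans_component[OF assms(1,2)] unfolding sset_map_def Simp_simplex by blast
  then have "\<beta> i m (Act (simplex {..i}) m i f (\<lambda>j\<in>{..i}. j)) =
      Act (DOb X (FOb \<sigma> i)) m i f (\<beta> i i (\<lambda>j\<in>{..i}. j))"
    using f id_in_delta[of i i] by blast
  ultimately show ?thesis
    using assms(2) by (simp only: tuple_def restrict_apply' atMost_iff)
qed

lemma tuple_Act:
  assumes "(\<sigma>, \<beta>) \<in> Simp (integral D X) n" "\<theta> \<in> delta_hom m n" "j \<le> m"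
  shows "tuple m (snd (Act (integral D X) m n \<theta> (\<sigma>, \<beta>))) j =
    Act (DOb X (FOb \<sigma> (\<theta> j))) j (\<theta> j) (restrict \<theta> {..j}) (tuple n \<beta> (\<theta> j))"
proof -
  have \<beta>: "sset_nat_trans (ordinal n) last_faces (diagram_comp X \<sigma>) \<beta>"
    using assms(1) by (simp add: integral_def)
  have th: "restrict \<theta> {..j} \<in> delta_hom j (\<theta> j)" and "\<theta> j \<le> n"
    using assms(2,3) by (auto simp: delta_hom_def mono_on_def)
  have "compose {..j} \<theta> (\<lambda>x\<in>{..j}. x) = restrict \<theta> {..j}"
    by (auto simp: compose_def)
  with assms(3) id_in_delta[of j j]
  have "tuple m (snd (Act (integral D X) m n \<theta> (\<sigma>, \<beta>))) j = \<beta> (\<theta> j) j (restrict \<theta> {..j})"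
    by (simp add: tuple_def integral_def smap_comp_def simplex_map_def Simp_simplex compose_eq)
  also note nat_trans_eval[OF \<beta> \<open>\<theta> j \<le> n\<close> th]
  finally show ?thesis .
qed

lemma tuple_in:
  assumes "sset_nat_trans (ordinal n) last_faces (diagram_comp X \<sigma>) \<beta>" "i \<le> n"
  shows "tuple n \<beta> i \<in> Simp (DOb X (FOb \<sigma> i)) i"
proof -
  have "\<beta> i i \<in> delta_hom i i \<rightarrow>\<^sub>E Simp (DOb X (FOb \<sigma> i)) i"
    using nat_trans_component[OF assms] unfolding sset_map_def Simp_simplex by blast
  then show ?thesis using id_in_delta[of i i] assms(2) by (auto simp: tuple_def)
qed

lemma nerve_Ob: "\<sigma> \<in> Simp (nerve D) n \<Longrightarrow> i \<le> n \<Longrightarrow> FOb \<sigma> i \<in> Ob D"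
  by (auto simp: nerve_def is_functor_def ordinal_def)

lemma tuple_Act_id:
  assumes "sset_functor D X" "(\<sigma>, \<beta>) \<in> Simp (integral D X) n" "i \<le> n"
  shows "Act (DOb X (FOb \<sigma> i)) i i (\<lambda>x\<in>{..i}. x) (tuple n \<beta> i) = tuple n \<beta> i"
proof -
  have "simplicial_set (DOb X (FOb \<sigma> i))"
    using assms nerve_Ob[of \<sigma> D n i] by (auto simp: sset_functor_def integral_def)
  then show ?thesis
    using tuple_in[of n X \<sigma> \<beta> i] assms(2,3) simplicial_set.Act_id by (auto simp: integral_def)
qed

lemma tuple_face:
  assumes "sset_functor D X" "(\<sigma>, \<beta>) \<in> Simp (integral D X) (Suc n)" "i \<le> Suc n"
  shows "tuple n (snd (Act (integral D X) n (Suc n) (coface n i) (\<sigma>, \<beta>))) =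
    (\<lambda>j\<in>{..n}. if j < i then tuple (Suc n) \<beta> j
       else Act (DOb X (FOb \<sigma> (Suc j))) j (Suc j) (coface j i) (tuple (Suc n) \<beta> (Suc j)))"
proof
  fix j
  show "tuple n (snd (Act (integral D X) n (Suc n) (coface n i) (\<sigma>, \<beta>))) j =
    (\<lambda>j\<in>{..n}. if j < i then tuple (Suc n) \<beta> j
       else Act (DOb X (FOb \<sigma> (Suc j))) j (Suc j) (coface j i) (tuple (Suc n) \<beta> (Suc j))) j"
  proof (cases "j \<le> n")
    case True
    have r: "restrict (coface n i) {..j} = (if j < i then (\<lambda>x\<in>{..j}. x) else coface j i)"
      using True by (auto simp: coface_def fun_eq_iff)
    have c: "coface n i j = (if j < i then j else Suc j)"
      using True by (simp add: coface_def)
    show ?thesis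
      unfolding tuple_Act[OF assms(2) coface_in True] r c
      using True tuple_Act_id[OF assms(1,2), of j] by simp
  qed (simp add: tuple_def)
qed

lemma tuple_degeneracy:
  assumes "sset_functor D X" "(\<sigma>, \<beta>) \<in> Simp (integral D X) n" "i \<le> n"
  shows "tuple (Suc n) (snd (Act (integral D X) (Suc n) n (codegeneracy n i) (\<sigma>, \<beta>))) =
    (\<lambda>j\<in>{..Suc n}. if j \<le> i then tuple n \<beta> j
       else Act (DOb X (FOb \<sigma> (j - 1))) j (j - 1) (codegeneracy (j - 1) i) (tuple n \<beta> (j - 1)))"
proof
  fix j
  show "tuple (Suc n) (snd (Act (integral D X) (Suc n) n (codegeneracy n i) (\<sigma>, \<beta>))) j =
    (\<lambda>j\<in>{..Suc n}. if j \<le> i then tuple n \<beta> j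
       else Act (DOb X (FOb \<sigma> (j - 1))) j (j - 1) (codegeneracy (j - 1) i) (tuple n \<beta> (j - 1))) j"
  proof (cases "j \<le> Suc n")
    case True
    have r: "restrict (codegeneracy n i) {..j} =
        (if j \<le> i then (\<lambda>x\<in>{..j}. x) else codegeneracy (j - 1) i)"
      using True by (auto simp: codegeneracy_def fun_eq_iff)
    have c: "codegeneracy n i j = (if j \<le> i then j else j - 1)"
      using True by (simp add: codegeneracy_def)
    show ?thesis
      unfolding tuple_Act[OF assms(2) codegeneracy_in[OF assms(3)] True] r c
      using True assms(3) tuple_Act_id[OF assms(1,2), of j] by simp
  qed (simp add: tuple_def)
qed

lemma nat_trans_natural:
  assumes "sset_nat_trans (ordinal n) last_faces (diagram_comp X \<sigma>) \<beta>" "i \<le> j" "j \<le> n"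
    and f: "f \<in> delta_hom m i"
  shows "\<beta> j m f = DAr X (FAr \<sigma> (i, j)) m (\<beta> i m f)"
proof -
  have "(i, j) \<in> Ar (ordinal n)" using assms by (simp add: ordinal_def)
  then have "smap_comp (simplex {..i}) (\<beta> j) (simplex_incl {..i})
      = smap_comp (simplex {..i}) (DAr X (FAr \<sigma> (i, j))) (\<beta> i)"
    using assms(1)
    by (auto simp: sset_nat_trans_def ordinal_def last_faces_def diagram_comp_def)
  then have "smap_comp (simplex {..i}) (\<beta> j) (simplex_incl {..i}) m f
      = smap_comp (simplex {..i}) (DAr X (FAr \<sigma> (i, j))) (\<beta> i) m f" by simp
  moreover have "compose {..m} (\<lambda>i. i) f = f"
    using f by (auto simp: delta_hom_def compose_def PiE_def extensional_def fun_eq_iff)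
  ultimately show ?thesis
    using f by (simp add: smap_comp_def simplex_map_def Simp_simplex compose_eq)
qed

lemma tuple_bij:
  assumes X: "sset_functor D X" and \<sigma>: "\<sigma> \<in> Simp (nerve D) n"
  shows "bij_betw (tuple n)
    {\<beta>. sset_nat_trans (ordinal n) last_faces (diagram_comp X \<sigma>) \<beta>} (tuples X n \<sigma>)"
  unfolding bij_betw_def
proof (intro conjI inj_onI subset_antisym subsetI)
  fix \<beta> \<gamma>
  assume \<beta>: "\<beta> \<in> {\<beta>. sset_nat_trans (ordinal n) last_faces (diagram_comp X \<sigma>) \<beta>}"
    and \<gamma>: "\<gamma> \<in> {\<beta>. sset_nat_trans (ordinal n) last_faces (diagram_comp X \<sigma>) \<beta>}"
    and eq: "tuple n \<beta> = tuple n \<gamma>"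
  show "\<beta> = \<gamma>"
  proof (rule extensionalityI[where A = "{..n}"])
    show "\<beta> \<in> extensional {..n}" "\<gamma> \<in> extensional {..n}"
      using \<beta> \<gamma> by (auto simp: sset_nat_trans_def ordinal_def)
    fix i assume "i \<in> {..n}"
    then have i: "i \<le> n" by simp
    show "\<beta> i = \<gamma> i"
    proof
      fix m
      show "\<beta> i m = \<gamma> i m"
      proof (rule extensionalityI[where A = "delta_hom m i"])
        show "\<beta> i m \<in> extensional (delta_hom m i)" "\<gamma> i m \<in> extensional (delta_hom m i)"
          using nat_trans_component[OF _ i, of X \<sigma>] \<beta> \<gamma>
          unfolding sset_map_def Simp_simplex PiE_def by blast+
        fix f assume "f \<in> delta_hom m i"
        then show "\<beta> i m f = \<gamma> i m f"
          using nat_trans_eval[OF _ i, of X \<sigma> \<beta>] nat_trans_eval[OF _ i, of X \<sigma> \<gamma>] \<beta> \<gamma> eq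
          by simp
      qed
    qed
  qed
next
  fix b assume "b \<in> tuple n ` {\<beta>. sset_nat_trans (ordinal n) last_faces (diagram_comp X \<sigma>) \<beta>}"
  then obtain \<beta> where \<beta>: "sset_nat_trans (ordinal n) last_faces (diagram_comp X \<sigma>) \<beta>"
    and b: "b = tuple n \<beta>" by blast
  have "b \<in> (\<Pi>\<^sub>E i\<in>{..n}. Simp (DOb X (FOb \<sigma> i)) i)"
    using tuple_in[OF \<beta>] by (auto simp: b tuple_def)
  moreover have "DAr X (FAr \<sigma> (i - 1, i)) (i - 1) (b (i - 1)) =
       Act (DOb X (FOb \<sigma> i)) (i - 1) i (coface (i - 1) i) (b i)" if i: "i \<in> {1..n}" for i
  proof -
    have c: "coface (i - 1) i = (\<lambda>x\<in>{..i - 1}. x)"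
      using i by (auto simp: coface_def fun_eq_iff)
    have "DAr X (FAr \<sigma> (i - 1, i)) (i - 1) (b (i - 1)) = \<beta> i (i - 1) (\<lambda>x\<in>{..i - 1}. x)"
      using nat_trans_natural[OF \<beta>, of "i - 1" i] i id_in_delta[of "i - 1" "i - 1"]
      by (auto simp: b tuple_def)
    also have "\<dots> = Act (DOb X (FOb \<sigma> i)) (i - 1) i (coface (i - 1) i) (b i)"
      unfolding c b using nat_trans_eval[OF \<beta>, of i] i id_in_delta[of "i - 1" i] by simp
    finally show ?thesis .
  qed
  ultimately show "b \<in> tuples X n \<sigma>" unfolding tuples_def by blast
next
  fix b assume b: "b \<in> tuples X n \<sigma>"
  define \<beta> where "\<beta> = (\<lambda>i\<in>{..n}. \<lambda>m. \<lambda>f\<in>delta_hom m i. Act (DOb X (FOb \<sigma> i)) m i f (b i))"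
  have F: "is_functor (ordinal n) D \<sigma>" using \<sigma> by (simp add: nerve_def)
  have bP: "b \<in> (\<Pi>\<^sub>E i\<in>{..n}. Simp (DOb X (FOb \<sigma> i)) i)"
    and bd: "\<forall>i\<in>{1..n}. DAr X (FAr \<sigma> (i - 1, i)) (i - 1) (b (i - 1)) =
       Act (DOb X (FOb \<sigma> i)) (i - 1) i (coface (i - 1) i) (b i)"
    using b unfolding tuples_def by blast+
  have bi: "b i \<in> Simp (DOb X (FOb \<sigma> i)) i" if "i \<le> n" for i
    using bP that by auto
  have ss: "simplicial_set (DOb X (FOb \<sigma> i))" if "i \<le> n" for i
    using X nerve_Ob[OF \<sigma> that] by (simp add: sset_functor_def)
  have ar: "FAr \<sigma> (i, j) \<in> Ar D" "Dom D (FAr \<sigma> (i, j)) = FOb \<sigma> i" "Cod D (FAr \<sigma> (i, j)) = FOb \<sigma> j"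
    if "i \<le> j" "j \<le> n" for i j
  proof -
    have a: "(i, j) \<in> Ar (ordinal n)" using that by (simp add: ordinal_def)
    show "FAr \<sigma> (i, j) \<in> Ar D" using F a unfolding is_functor_def by blast
    have "Dom D (FAr \<sigma> (i, j)) = FOb \<sigma> (Dom (ordinal n) (i, j))"
      "Cod D (FAr \<sigma> (i, j)) = FOb \<sigma> (Cod (ordinal n) (i, j))"
      using F a unfolding is_functor_def by blast+
    then show "Dom D (FAr \<sigma> (i, j)) = FOb \<sigma> i" "Cod D (FAr \<sigma> (i, j)) = FOb \<sigma> j"
      by (simp_all add: ordinal_def)
  qed
  have Xm: "sset_map (DOb X (FOb \<sigma> i)) (DOb X (FOb \<sigma> j)) (DAr X (FAr \<sigma> (i, j)))"
    if "i \<le> j" "j \<le> n" for i j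
  proof -
    have "sset_map (DOb X (Dom D (FAr \<sigma> (i, j)))) (DOb X (Cod D (FAr \<sigma> (i, j)))) (DAr X (FAr \<sigma> (i, j)))"
      using X ar(1)[OF that] unfolding sset_functor_def by blast
    then show ?thesis unfolding ar(2,3)[OF that] .
  qed
  have Xnat: "DAr X (FAr \<sigma> (i, j)) m (Act (DOb X (FOb \<sigma> i)) m k \<theta> x) =
      Act (DOb X (FOb \<sigma> j)) m k \<theta> (DAr X (FAr \<sigma> (i, j)) k x)"
    if "i \<le> j" "j \<le> n" "\<theta> \<in> delta_hom m k" "x \<in> Simp (DOb X (FOb \<sigma> i)) k" for i j m k \<theta> x
    using Xm[OF that(1,2)] that(3,4) unfolding sset_map_def by blast
  have Xid: "DAr X (FAr \<sigma> (i, i)) = smap_id (DOb X (FOb \<sigma> i))" if "i \<le> n" for i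
  proof -
    have "i \<in> Ob (ordinal n)" using that by (simp add: ordinal_def)
    then have "FAr \<sigma> (Idt (ordinal n) i) = Idt D (FOb \<sigma> i)"
      using F unfolding is_functor_def by blast
    then have "FAr \<sigma> (i, i) = Idt D (FOb \<sigma> i)" by (simp add: ordinal_def)
    moreover have "DAr X (Idt D (FOb \<sigma> i)) = smap_id (DOb X (FOb \<sigma> i))"
      using X nerve_Ob[OF \<sigma> that] unfolding sset_functor_def by blast
    ultimately show ?thesis by simp
  qed
  have Xcomp: "DAr X (FAr \<sigma> (i, k)) =
      smap_comp (DOb X (FOb \<sigma> i)) (DAr X (FAr \<sigma> (j, k))) (DAr X (FAr \<sigma> (i, j)))"
    if "i \<le> j" "j \<le> k" "k \<le> n" for i j k
  proof -
    have "(i, j) \<in> Ar (ordinal n)" "(j, k) \<in> Ar (ordinal n)"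
      "Cod (ordinal n) (i, j) = Dom (ordinal n) (j, k)"
      using that by (simp_all add: ordinal_def)
    then have "FAr \<sigma> (Comp (ordinal n) (j, k) (i, j)) = Comp D (FAr \<sigma> (j, k)) (FAr \<sigma> (i, j))"
      using F unfolding is_functor_def by blast
    then have e: "FAr \<sigma> (i, k) = Comp D (FAr \<sigma> (j, k)) (FAr \<sigma> (i, j))"
      by (simp add: ordinal_def)
    have a: "FAr \<sigma> (i, j) \<in> Ar D" "Dom D (FAr \<sigma> (i, j)) = FOb \<sigma> i" "FAr \<sigma> (j, k) \<in> Ar D"
      and c: "Cod D (FAr \<sigma> (i, j)) = Dom D (FAr \<sigma> (j, k))"
      using ar[of i j] ar[of j k] that by simp_all
    have "DAr X (Comp D (FAr \<sigma> (j, k)) (FAr \<sigma> (i, j))) = smap_comp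
        (DOb X (Dom D (FAr \<sigma> (i, j)))) (DAr X (FAr \<sigma> (j, k))) (DAr X (FAr \<sigma> (i, j)))"
      using X a(1,3) c unfolding sset_functor_def by blast
    then show ?thesis unfolding e a(2) .
  qed
  have step: "DAr X (FAr \<sigma> (i, j)) i (b i) = Act (DOb X (FOb \<sigma> j)) i j (\<lambda>x\<in>{..i}. x) (b j)"
    if "i \<le> j" "j \<le> n" for i j
    using that
  proof (induction j rule: dec_induct)
    case base
    then have i: "i \<le> n" by simp
    have "DAr X (FAr \<sigma> (i, i)) i (b i) = b i"
      unfolding Xid[OF i] smap_id_def using bi[OF i] by simp
    then show ?case unfolding simplicial_set.Act_id[OF ss[OF i] bi[OF i]] .
  next
    case (step j)
    then have le: "i \<le> j" "j \<le> n" "Suc j \<le> n" by auto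
    have c: "coface j (Suc j) = (\<lambda>x\<in>{..j}. x)" by (auto simp: coface_def fun_eq_iff)
    have cc: "compose {..i} (\<lambda>x\<in>{..j}. x) (\<lambda>x\<in>{..i}. x) = (\<lambda>x\<in>{..i}. x)"
      using le by (auto simp: compose_def fun_eq_iff)
    have d: "(\<lambda>x\<in>{..j}. x) \<in> delta_hom j (Suc j)" by (rule id_in_delta) simp
    have "Suc j \<in> {1..n}" using le by simp
    then have one: "DAr X (FAr \<sigma> (j, Suc j)) j (b j) =
        Act (DOb X (FOb \<sigma> (Suc j))) j (Suc j) (\<lambda>x\<in>{..j}. x) (b (Suc j))"
      using bspec[OF bd, of "Suc j"] unfolding c[symmetric] diff_Suc_1 by blast
    have "DAr X (FAr \<sigma> (i, Suc j)) i (b i) =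
        DAr X (FAr \<sigma> (j, Suc j)) i (DAr X (FAr \<sigma> (i, j)) i (b i))"
      using Xcomp[of i j "Suc j"] le bi[of i] by (simp add: smap_comp_def compose_eq)
    also have "\<dots> = DAr X (FAr \<sigma> (j, Suc j)) i (Act (DOb X (FOb \<sigma> j)) i j (\<lambda>x\<in>{..i}. x) (b j))"
      using step.IH[OF le(2)] by (rule arg_cong)
    also have "\<dots> = Act (DOb X (FOb \<sigma> (Suc j))) i j (\<lambda>x\<in>{..i}. x) (DAr X (FAr \<sigma> (j, Suc j)) j (b j))"
      using Xnat[OF _ le(3) id_in_delta[OF le(1)] bi[OF le(2)]] by simp
    also have "\<dots> = Act (DOb X (FOb \<sigma> (Suc j))) i (Suc j) (\<lambda>x\<in>{..i}. x) (b (Suc j))"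
      unfolding one
      using simplicial_set.Act_comp[OF ss[OF le(3)] id_in_delta[OF le(1)] d bi[OF le(3)]]
      unfolding cc by (rule sym)
    finally show ?case .
  qed
  have map: "sset_map (simplex {..i}) (DOb X (FOb \<sigma> i)) (\<beta> i)" if "i \<le> n" for i
    unfolding sset_map_def Simp_simplex
  proof (intro conjI allI ballI)
    fix m
    show "\<beta> i m \<in> delta_hom m i \<rightarrow>\<^sub>E Simp (DOb X (FOb \<sigma> i)) m"
      using that simplicial_set.Act_in[OF ss[OF that] _ bi[OF that]] by (auto simp: \<beta>_def)
  next
    fix m k \<theta> f assume \<theta>: "\<theta> \<in> delta_hom m k" and f: "f \<in> delta_hom k i"
    have "compose {..m} f \<theta> \<in> delta_hom m i"
      using \<theta> f by (auto simp: delta_hom_def compose_def mono_on_def PiE_def Pi_def)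
    then show "\<beta> i m (Act (simplex {..i}) m k \<theta> f) = Act (DOb X (FOb \<sigma> i)) m k \<theta> (\<beta> i k f)"
      using that simplicial_set.Act_comp[OF ss[OF that] \<theta> f bi[OF that]] f
      by (simp add: \<beta>_def simplex_def)
  qed
  have nat: "smap_comp (simplex {..i}) (\<beta> j) (simplex_incl {..i})
      = smap_comp (simplex {..i}) (DAr X (FAr \<sigma> (i, j))) (\<beta> i)" if ij: "i \<le> j" "j \<le> n" for i j
    unfolding smap_comp_def Simp_simplex
  proof (rule ext, rule extensionalityI)
    fix m
    show "compose (delta_hom m i) (\<beta> j m) (simplex_incl {..i} m) \<in> extensional (delta_hom m i)"
      "compose (delta_hom m i) (DAr X (FAr \<sigma> (i, j)) m) (\<beta> i m) \<in> extensional (delta_hom m i)"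
      by simp_all
    fix f assume f: "f \<in> delta_hom m i"
    have e1: "compose {..m} (\<lambda>i. i) f = f"
      using f by (auto simp: delta_hom_def compose_def PiE_def extensional_def fun_eq_iff)
    have e2: "compose {..m} (\<lambda>x\<in>{..i}. x) f = f"
      using f by (auto simp: delta_hom_def compose_def PiE_def Pi_def extensional_def fun_eq_iff)
    have fj: "f \<in> delta_hom m j" using f ij by (auto simp: delta_hom_def PiE_iff intro: order_trans)
    have "DAr X (FAr \<sigma> (i, j)) m (\<beta> i m f) =
        DAr X (FAr \<sigma> (i, j)) m (Act (DOb X (FOb \<sigma> i)) m i f (b i))"
      using f ij by (simp add: \<beta>_def)
    also have "\<dots> = Act (DOb X (FOb \<sigma> j)) m i f (DAr X (FAr \<sigma> (i, j)) i (b i))"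
      using Xnat[OF ij f bi] ij by simp
    also have "\<dots> = Act (DOb X (FOb \<sigma> j)) m j f (b j)"
      unfolding step[OF ij]
      using simplicial_set.Act_comp[OF ss[OF ij(2)] f id_in_delta[OF ij(1)] bi[OF ij(2)]]
      unfolding e2 by (rule sym)
    also have "\<dots> = \<beta> j m f" using fj ij by (simp add: \<beta>_def)
    finally show "compose (delta_hom m i) (\<beta> j m) (simplex_incl {..i} m) f
        = compose (delta_hom m i) (DAr X (FAr \<sigma> (i, j)) m) (\<beta> i m) f"
      using f e1 by (simp add: compose_eq simplex_map_def Simp_simplex)
  qed
  have "sset_nat_trans (ordinal n) last_faces (diagram_comp X \<sigma>) \<beta>"
    using map nat
    by (auto simp: sset_nat_trans_def ordinal_def last_faces_def diagram_comp_def \<beta>_def)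
  moreover have "tuple n \<beta> = b"
  proof (rule extensionalityI[where A = "{..n}"])
    show "b \<in> extensional {..n}" using bP by (simp add: PiE_def)
    fix i assume "i \<in> {..n}"
    then show "tuple n \<beta> i = b i"
      using simplicial_set.Act_id[OF ss bi, of i] id_in_delta[of i i] by (simp add: tuple_def \<beta>_def)
  qed (simp add: tuple_def)
  ultimately show "b \<in> tuple n ` {\<beta>. sset_nat_trans (ordinal n) last_faces (diagram_comp X \<sigma>) \<beta>}"
    by blast
qed

end

theory Submission
  imports Defs
begin

text \<open>
  Fix \<open>\<sigma> : [n] \<rightarrow> D\<close>.  Every nonempty \<open>K \<subseteq> [n]\<close> is contained in the initial segment \<open>{0, \<dots>, k}\<close>,
  \<open>k = Max K\<close>, which has the same maximum.  Since \<open>X\<close> sends the identity arrow \<open>k \<rightarrow> k\<close> to an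
  identity, the compatibility condition for \<open>K \<subseteq> {0, \<dots>, k}\<close> says that \<open>\<tau>\<^sup>K\<close> is simply the restriction
  of \<open>\<tau>\<^bsup>{0, \<dots>, k}\<^esup>\<close> to \<open>\<Delta>\<^sup>K\<close> (\<open>rel_nerve_component\<close>).  So a family \<open>\<tau>\<close> in the relative nerve carries
  no more information than its members \<open>\<beta>\<^sub>i = \<tau>\<^bsup>{0, \<dots>, i}\<^esup> : \<Delta>[i] \<rightarrow> X(\<sigma> i)\<close>, and for these the
  compatibility conditions are exactly the naturality of \<open>\<beta> : c(n) \<Rightarrow> X \<circ> \<sigma>\<close>.  Conversely, a natural
  transformation \<open>\<beta>\<close> extends to the family \<open>\<tau>\<^sup>K = \<beta>\<^sub>k|\<Delta>\<^sup>K\<close>, whose compatibility for \<open>I \<subseteq> K\<close> is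
  naturality of \<open>\<beta>\<close> at \<open>Max I \<rightarrow> Max K\<close>, restricted from \<open>\<Delta>[Max I]\<close> to \<open>\<Delta>\<^sup>I\<close>.  These two
  constructions, \<open>initial_segments\<close> and \<open>restrict_to_subposets\<close>, are mutually inverse.

  The extension \<open>\<beta> \<mapsto> \<tau>\<close> is the direction in which compatibility with \<open>\<theta> : [m] \<rightarrow> [n]\<close> is immediate:
  on the component at \<open>K\<close> both sides are \<open>h \<mapsto> \<beta>\<^bsub>\<theta> k\<^esub> (\<theta> \<circ> h)\<close>, because a monotone map satisfies
  \<open>Max (\<theta> K) = \<theta> (Max K)\<close> (\<open>restrict_to_subposets_Act\<close>).  For the inverse direction a direct
  calculation would have to compare \<open>\<theta> {0, \<dots>, j}\<close>, which in general is not an initial segment, with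
  \<open>{0, \<dots>, \<theta> j}\<close>; but a levelwise inverse of a simplicial bijection is automatically simplicial.
  By the same transport argument (\<open>iso_over_bijI\<close>) the relative nerve inherits from the
  simplicial set of pairs that it is a simplicial set over the nerve.
\<close>

section \<open>Monotone maps and simplicial maps\<close>

lemma delta_hom_mono: "\<lbrakk>\<theta> \<in> delta_hom m n; i \<le> j; j \<le> m\<rbrakk> \<Longrightarrow> \<theta> i \<le> \<theta> j"
  by (auto simp: delta_hom_def mono_on_def)

lemma delta_hom_le: "\<lbrakk>\<theta> \<in> delta_hom m n; i \<le> m\<rbrakk> \<Longrightarrow> \<theta> i \<le> n"
  by (auto simp: delta_hom_def)

lemma delta_hom_mono_on: "\<lbrakk>\<theta> \<in> delta_hom m n; K \<subseteq> {..m}\<rbrakk> \<Longrightarrow> mono_on K \<theta>"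
  by (auto simp: delta_hom_def intro: mono_on_subset)

lemma delta_hom_comp:
  "\<lbrakk>\<phi> \<in> delta_hom k m; \<theta> \<in> delta_hom m n\<rbrakk> \<Longrightarrow> compose {..k} \<theta> \<phi> \<in> delta_hom k n"
  by (auto simp: delta_hom_def compose_def mono_on_def PiE_def Pi_def)

lemma sset_map_in: "\<lbrakk>sset_map A B f; x \<in> Simp A n\<rbrakk> \<Longrightarrow> f n x \<in> Simp B n"
  unfolding sset_map_def by blast

lemma sset_map_natural:
  "\<lbrakk>sset_map A B f; \<theta> \<in> delta_hom m n; x \<in> Simp A n\<rbrakk>
    \<Longrightarrow> f m (Act A m n \<theta> x) = Act B m n \<theta> (f n x)"
  unfolding sset_map_def by blast

lemma sset_map_eqI:
  assumes f: "sset_map A B f" and g: "sset_map A C g"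
    and eq: "\<And>n x. x \<in> Simp A n \<Longrightarrow> f n x = g n x"
  shows "f = g"
proof
  fix n
  show "f n = g n"
  proof (rule extensionalityI[where A = "Simp A n"])
    show "f n \<in> extensional (Simp A n)" "g n \<in> extensional (Simp A n)"
      using f g unfolding sset_map_def PiE_def by blast+
  qed (rule eq)
qed

lemma smap_comp_apply [simp]: "x \<in> Simp A n \<Longrightarrow> smap_comp A g f n x = g n (f n x)"
  by (simp add: smap_comp_def compose_eq)

lemma smap_comp_eq_iff:
  "smap_comp A g f = smap_comp A g' f' \<longleftrightarrow> (\<forall>n. \<forall>x\<in>Simp A n. g n (f n x) = g' n (f' n x))"
  unfolding smap_comp_def compose_def fun_eq_iff by (auto simp: restrict_def)

lemma sset_map_comp:
  assumes f: "sset_map A B f" and g: "sset_map B C g" and A: "simplicial_set A"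
  shows "sset_map A C (smap_comp A g f)"
  unfolding sset_map_def
proof (intro conjI allI ballI)
  show "smap_comp A g f n \<in> Simp A n \<rightarrow>\<^sub>E Simp C n" for n
    using sset_map_in[OF f] sset_map_in[OF g] by (auto simp: smap_comp_def compose_def)
  show "smap_comp A g f m (Act A m n \<theta> x) = Act C m n \<theta> (smap_comp A g f n x)"
    if "\<theta> \<in> delta_hom m n" "x \<in> Simp A n" for m n \<theta> x
    using that simplicial_set.Act_in[OF A that] sset_map_in[OF f that(2)]
    by (simp add: sset_map_natural[OF f] sset_map_natural[OF g])
qed

text \<open>
  The identities of a simplicial set, the simpliciality of the inverse and the simpliciality of \<open>q\<close>
  are all equations between values on simplices of \<open>A'\<close>, so they can be pulled back to \<open>A\<close> along
  the surjections \<open>f n\<close>.  This yields the simplicial structure of \<open>A'\<close> along with the isomorphism,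
  and only one of the two sides has to be checked by hand.
\<close>

lemma iso_over_bijI:
  assumes p: "over B A p"
    and ext: "\<And>n. f n \<in> extensional (Simp A n)"
    and bij: "\<And>n. bij_betw (f n) (Simp A n) (Simp A' n)"
    and act: "\<And>m n \<theta> x. \<lbrakk>\<theta> \<in> delta_hom m n; x \<in> Simp A n\<rbrakk>
      \<Longrightarrow> f m (Act A m n \<theta> x) = Act A' m n \<theta> (f n x)"
    and q: "\<And>n. q n \<in> extensional (Simp A' n)"
    and qf: "\<And>n x. x \<in> Simp A n \<Longrightarrow> q n (f n x) = p n x"
  shows "iso_over B A p A' q"
proof -
  have A: "simplicial_set A" and B: "simplicial_set B" and pm: "sset_map A B p"
    using p by (auto simp: over_def)
  have f_in: "f n x \<in> Simp A' n" if "x \<in> Simp A n" for n x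
    using bij_betwE[OF bij] that by blast
  have ex: "\<exists>x\<in>Simp A n. y = f n x" if "y \<in> Simp A' n" for n y
    using bij_betw_imp_surj_on[OF bij, of n] that by blast
  define g where "g = (\<lambda>n. \<lambda>y\<in>Simp A' n. inv_into (Simp A n) (f n) y)"
  have gf: "g n (f n x) = x" if "x \<in> Simp A n" for n x
    using bij_betw_inv_into_left[OF bij that] f_in[OF that] by (simp add: g_def)
  have fg: "f n (g n y) = y" if "y \<in> Simp A' n" for n y
    using ex[OF that] gf by auto
  have A': "simplicial_set A'"
  proof
    fix m n \<theta> y assume \<theta>: "\<theta> \<in> delta_hom m n" and "y \<in> Simp A' n"
    then obtain x where "x \<in> Simp A n" "y = f n x" using ex by blast
    then show "Act A' m n \<theta> y \<in> Simp A' m"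
      using act[OF \<theta>, symmetric] f_in simplicial_set.Act_in[OF A \<theta>] by simp
  next
    fix y n assume "y \<in> Simp A' n"
    then obtain x where x: "x \<in> Simp A n" "y = f n x" using ex by blast
    have "(\<lambda>i\<in>{..n}. i) \<in> delta_hom n n" by (rule id_in_delta) simp
    then show "Act A' n n (\<lambda>i\<in>{..n}. i) y = y"
      using act[of _ n n x, symmetric] simplicial_set.Act_id[OF A x(1)] x by simp
  next
    fix \<phi> k m \<theta> n y
    assume \<phi>: "\<phi> \<in> delta_hom k m" and \<theta>: "\<theta> \<in> delta_hom m n" and "y \<in> Simp A' n"
    then obtain x where x: "x \<in> Simp A n" "y = f n x" using ex by blast
    show "Act A' k n (compose {..k} \<theta> \<phi>) y = Act A' k m \<phi> (Act A' m n \<theta> y)"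
      using act[OF delta_hom_comp[OF \<phi> \<theta>] x(1)] act[OF \<theta> x(1)]
        act[OF \<phi> simplicial_set.Act_in[OF A \<theta> x(1)]] simplicial_set.Act_comp[OF A \<phi> \<theta> x(1)]
      by (simp add: x(2))
  qed
  have fm: "sset_map A A' f"
    using ext f_in act unfolding sset_map_def PiE_def by blast
  have gm: "sset_map A' A g"
    unfolding sset_map_def
  proof (intro conjI allI ballI)
    show "g n \<in> Simp A' n \<rightarrow>\<^sub>E Simp A n" for n
    proof
      show "g n y \<in> Simp A n" if "y \<in> Simp A' n" for y
        using ex[OF that] gf by auto
    qed (simp add: g_def)
    fix m n \<theta> y assume \<theta>: "\<theta> \<in> delta_hom m n" and "y \<in> Simp A' n"
    then obtain x where "x \<in> Simp A n" "y = f n x" using ex by blast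
    then show "g m (Act A' m n \<theta> y) = Act A m n \<theta> (g n y)"
      using act[OF \<theta>, symmetric] gf simplicial_set.Act_in[OF A \<theta>] by simp
  qed
  have qm: "sset_map A' B q"
    unfolding sset_map_def
  proof (intro conjI allI ballI)
    show "q n \<in> Simp A' n \<rightarrow>\<^sub>E Simp B n" for n
    proof
      show "q n y \<in> Simp B n" if "y \<in> Simp A' n" for y
        using ex[OF that] qf sset_map_in[OF pm] by auto
      show "q n y = undefined" if "y \<notin> Simp A' n" for y
        using extensional_arb[OF q that] .
    qed
    fix m n \<theta> y assume \<theta>: "\<theta> \<in> delta_hom m n" and "y \<in> Simp A' n"
    then obtain x where "x \<in> Simp A n" "y = f n x" using ex by blast
    then show "q m (Act A' m n \<theta> y) = Act B m n \<theta> (q n y)"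
      using act[OF \<theta>, symmetric] qf simplicial_set.Act_in[OF A \<theta>] sset_map_natural[OF pm \<theta>]
      by simp
  qed
  have "smap_comp A q f = p"
    by (rule sset_map_eqI[OF sset_map_comp[OF fm qm A] pm]) (simp add: qf)
  moreover have "smap_comp A' p g = q"
    by (rule sset_map_eqI[OF sset_map_comp[OF gm pm A'] qm]) (use ex gf qf in force)
  moreover have "smap_comp A g f = smap_id A"
    by (auto simp: smap_comp_def smap_id_def compose_def gf intro!: restrict_ext)
  moreover have "smap_comp A' f g = smap_id A'"
    by (auto simp: smap_comp_def smap_id_def compose_def fg intro!: restrict_ext)
  ultimately show ?thesis
    using p A' B fm gm qm unfolding iso_over_def over_def over_map_def by blast
qed

section \<open>Simplices and subposets\<close>

lemma simplex_simplicial_set: "simplicial_set (simplex K)"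
  by unfold_locales
    (auto simp: simplex_def delta_hom_def compose_def mono_on_def PiE_def Pi_def
      extensional_def fun_eq_iff)

lemma Simp_simplex_mono: "\<lbrakk>h \<in> Simp (simplex I) p; I \<subseteq> K\<rbrakk> \<Longrightarrow> h \<in> Simp (simplex K) p"
  by (auto simp: simplex_def)

lemma simplex_map_apply:
  "h \<in> Simp (simplex K) p \<Longrightarrow> simplex_map K \<theta> p h = compose {..p} \<theta> h"
  by (simp add: simplex_map_def)

lemma simplex_incl_apply [simp]: "h \<in> Simp (simplex I) p \<Longrightarrow> simplex_incl I p h = h"
  by (auto simp: simplex_map_apply simplex_def compose_def PiE_def extensional_def fun_eq_iff)

lemma compose_in_simplex:
  assumes "h \<in> Simp (simplex K) p" "mono_on K \<theta>" "\<theta> ` K \<subseteq> L"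
  shows "compose {..p} \<theta> h \<in> Simp (simplex L) p"
  using assms by (auto simp: simplex_def compose_def mono_on_def PiE_def Pi_def)

lemma sset_map_simplex_map:
  assumes "mono_on K \<theta>" "\<theta> ` K \<subseteq> L"
  shows "sset_map (simplex K) (simplex L) (simplex_map K \<theta>)"
  unfolding sset_map_def
proof (intro conjI allI ballI)
  show "simplex_map K \<theta> p \<in> Simp (simplex K) p \<rightarrow>\<^sub>E Simp (simplex L) p" for p
    using compose_in_simplex[OF _ assms] by (auto simp: simplex_map_def)
  fix m p \<phi> h assume \<phi>: "\<phi> \<in> delta_hom m p" and h: "h \<in> Simp (simplex K) p"
  have "Act (simplex K) m p \<phi> h \<in> Simp (simplex K) m"
    by (rule simplicial_set.Act_in[OF simplex_simplicial_set \<phi> h])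
  then show "simplex_map K \<theta> m (Act (simplex K) m p \<phi> h)
      = Act (simplex L) m p \<phi> (simplex_map K \<theta> p h)"
    using \<phi> h by (auto simp: simplex_map_apply simplex_def compose_def delta_hom_def
        PiE_def Pi_def fun_eq_iff)
qed

lemma subposetsD:
  assumes "K \<in> subposets n"
  shows "Max K \<in> K" "Max K \<le> n" "K \<subseteq> {..Max K}"
proof -
  have K: "finite K" "K \<noteq> {}" "K \<subseteq> {..n}"
    using assms finite_subset by (auto simp: subposets_def)
  then show "Max K \<in> K" "K \<subseteq> {..Max K}" by auto
  then show "Max K \<le> n" using K by auto
qed

lemma Max_mono_subposets: "\<lbrakk>K \<in> subposets n; I \<in> subposets n; I \<subseteq> K\<rbrakk> \<Longrightarrow> Max I \<le> Max K"
  using subposetsD by blast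

lemma atMost_in_subposets: "i \<le> n \<Longrightarrow> {..i} \<in> subposets n"
  by (auto simp: subposets_def)

lemma Max_atMost_nat: "Max {..i::nat} = i"
  by (rule Max_eqI) auto

lemma image_in_subposets:
  assumes "\<theta> \<in> delta_hom m n" "K \<in> subposets m"
  shows "\<theta> ` K \<in> subposets n"
  using assms by (auto simp: subposets_def delta_hom_def)

text \<open>
  The \<open>K\<close>-component of a family pulled back along \<open>\<theta>\<close> is made from the \<open>\<theta>(K)\<close>-component, which lands
  in the value of \<open>X\<close> over \<open>Max (\<theta> K)\<close>, whereas the functor pulled back along \<open>\<theta>\<close> asks for the value
  over \<open>\<theta> (Max K)\<close>.
\<close>

lemma Max_image_delta:
  assumes \<theta>: "\<theta> \<in> delta_hom m n" and K: "K \<in> subposets m"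
  shows "Max (\<theta> ` K) = \<theta> (Max K)"
proof (rule Max_eqI)
  show "finite (\<theta> ` K)"
    using K finite_subset by (auto simp: subposets_def)
  show "y \<le> \<theta> (Max K)" if "y \<in> \<theta> ` K" for y
    using that subposetsD[OF K] delta_hom_mono[OF \<theta>] by blast
  show "\<theta> (Max K) \<in> \<theta> ` K" using subposetsD(1)[OF K] by (rule imageI)
qed

section \<open>The nerve\<close>

lemma is_functor_comp:
  assumes F: "is_functor C D F" and G: "is_functor D E G" and C: "category C"
  shows "is_functor C E (functor_comp C G F)"
proof -
  have Fo: "\<And>a. a \<in> Ob C \<Longrightarrow> FOb F a \<in> Ob D" and Fa: "\<And>f. f \<in> Ar C \<Longrightarrow> FAr F f \<in> Ar D"
    and Go: "\<And>a. a \<in> Ob D \<Longrightarrow> FOb G a \<in> Ob E" and Ga: "\<And>f. f \<in> Ar D \<Longrightarrow> FAr G f \<in> Ar E"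
    using F G unfolding is_functor_def by blast+
  interpret category C by (rule C)
  show ?thesis
    using F G unfolding is_functor_def functor_comp_def
    by (auto simp: compose_def Fo Fa Go Ga Dom_in Cod_in Idt_in Comp_in)
qed

lemma category_ordinal: "category (ordinal n)"
  by unfold_locales (auto simp: ordinal_def)

lemma ordinal_map_functor:
  "\<theta> \<in> delta_hom m n \<Longrightarrow> is_functor (ordinal m) (ordinal n) (ordinal_map m \<theta>)"
  using delta_hom_mono[of \<theta> m n] delta_hom_le[of \<theta> m n]
  by (auto simp: is_functor_def ordinal_def ordinal_map_def)

lemma FOb_Act_nerve [simp]: "i \<le> m \<Longrightarrow> FOb (Act (nerve D) m n \<theta> \<sigma>) i = FOb \<sigma> (\<theta> i)"
  by (simp add: nerve_def functor_comp_def ordinal_map_def ordinal_def compose_def)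

lemma FAr_Act_nerve [simp]:
  "\<lbrakk>i \<le> j; j \<le> m\<rbrakk> \<Longrightarrow> FAr (Act (nerve D) m n \<theta> \<sigma>) (i, j) = FAr \<sigma> (\<theta> i, \<theta> j)"
  by (simp add: nerve_def functor_comp_def ordinal_map_def ordinal_def compose_def)

lemma nerve_eqI:
  assumes \<sigma>: "\<sigma> \<in> Simp (nerve D) n" and \<rho>: "\<rho> \<in> Simp (nerve D) n"
    and ob: "\<And>i. i \<le> n \<Longrightarrow> FOb \<sigma> i = FOb \<rho> i"
    and ar: "\<And>i j. \<lbrakk>i \<le> j; j \<le> n\<rbrakk> \<Longrightarrow> FAr \<sigma> (i, j) = FAr \<rho> (i, j)"
  shows "\<sigma> = \<rho>"
proof (rule funct.equality)
  have F: "is_functor (ordinal n) D \<sigma>" "is_functor (ordinal n) D \<rho>"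
    using \<sigma> \<rho> by (simp_all add: nerve_def)
  show "FOb \<sigma> = FOb \<rho>"
  proof (rule extensionalityI[where A = "Ob (ordinal n)"])
    show "FOb \<sigma> \<in> extensional (Ob (ordinal n))" "FOb \<rho> \<in> extensional (Ob (ordinal n))"
      using F unfolding is_functor_def PiE_def by blast+
  qed (simp add: ordinal_def ob)
  show "FAr \<sigma> = FAr \<rho>"
  proof (rule extensionalityI[where A = "Ar (ordinal n)"])
    show "FAr \<sigma> \<in> extensional (Ar (ordinal n))" "FAr \<rho> \<in> extensional (Ar (ordinal n))"
      using F unfolding is_functor_def PiE_def by blast+
  qed (auto simp: ordinal_def ar)
qed simp

lemma nerve_simplicial_set: "simplicial_set (nerve D)"
proof -
  have Act_in: "Act (nerve D) m n \<theta> \<sigma> \<in> Simp (nerve D) m"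
    if "\<theta> \<in> delta_hom m n" "\<sigma> \<in> Simp (nerve D) n" for \<theta> m n \<sigma>
    using is_functor_comp[OF ordinal_map_functor[OF that(1)] _ category_ordinal] that(2)
    by (simp add: nerve_def)
  show ?thesis
  proof
    show "Act (nerve D) n n (\<lambda>i\<in>{..n}. i) \<sigma> = \<sigma>" if "\<sigma> \<in> Simp (nerve D) n" for n \<sigma>
      by (rule nerve_eqI[OF Act_in[OF id_in_delta that] that]) auto
    show "Act (nerve D) k n (compose {..k} \<theta> \<phi>) \<sigma> = Act (nerve D) k m \<phi> (Act (nerve D) m n \<theta> \<sigma>)"
      if "\<phi> \<in> delta_hom k m" "\<theta> \<in> delta_hom m n" "\<sigma> \<in> Simp (nerve D) n" for \<phi> k m \<theta> n \<sigma>
      using that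
      by (intro nerve_eqI[of _ D k] Act_in delta_hom_comp)
        (auto simp: compose_eq delta_hom_le delta_hom_mono)
  qed (rule Act_in)
qed

section \<open>The simplicial set of pairs\<close>

text \<open>
  Since \<open>c(n)\<close> sends \<open>i \<rightarrow> j\<close> to an inclusion, a simplex \<open>h\<close> of \<open>\<Delta>[i]\<close> is literally the same function
  as its image in \<open>\<Delta>[j]\<close>.  Naturality therefore becomes an equation between values at one and
  the same \<open>h\<close>, with no composition of maps left in it.
\<close>

lemma integral_Simp_iff:
  "(\<sigma>, \<beta>) \<in> Simp (integral D X) n \<longleftrightarrow>
    \<sigma> \<in> Simp (nerve D) n \<and> \<beta> \<in> extensional {..n} \<and>
    (\<forall>i\<le>n. sset_map (simplex {..i}) (DOb X (FOb \<sigma> i)) (\<beta> i)) \<and>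
    (\<forall>j\<le>n. \<forall>i\<le>j. \<forall>p. \<forall>h\<in>Simp (simplex {..i}) p.
       \<beta> j p h = DAr X (FAr \<sigma> (i, j)) p (\<beta> i p h))"
  unfolding integral_def sset_nat_trans_def last_faces_def diagram_comp_def ordinal_def
  by (auto simp: smap_comp_eq_iff)

lemma fst_integral_in_nerve: "s \<in> Simp (integral D X) n \<Longrightarrow> fst s \<in> Simp (nerve D) n"
  by (auto simp: integral_def)

lemma fst_Act_integral: "fst (Act (integral D X) m n \<theta> s) = Act (nerve D) m n \<theta> (fst s)"
  by (simp add: integral_def split_beta)

lemma snd_Act_integral:
  assumes "j \<le> m" "h \<in> Simp (simplex {..j}) p"
  shows "snd (Act (integral D X) m n \<theta> s) j p h = snd s (\<theta> j) p (compose {..p} \<theta> h)"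
  using assms by (simp add: integral_def simplex_map_apply split_beta)

lemma integral_eqI:
  assumes s: "s \<in> Simp (integral D X) n" and t: "t \<in> Simp (integral D X) n"
    and fst: "fst s = fst t"
    and snd: "\<And>i p h. \<lbrakk>i \<le> n; h \<in> Simp (simplex {..i}) p\<rbrakk> \<Longrightarrow> snd s i p h = snd t i p h"
  shows "s = t"
proof (rule prod_eqI)
  have s': "(fst s, snd s) \<in> Simp (integral D X) n" and t': "(fst t, snd t) \<in> Simp (integral D X) n"
    using s t by simp_all
  show "snd s = snd t"
  proof (rule extensionalityI[where A = "{..n}"])
    show "snd s \<in> extensional {..n}" "snd t \<in> extensional {..n}"
      using s' t' unfolding integral_Simp_iff by blast+
    fix i assume i: "i \<in> {..n}"
    have "sset_map (simplex {..i}) (DOb X (FOb (fst s) i)) (snd s i)"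
      "sset_map (simplex {..i}) (DOb X (FOb (fst t) i)) (snd t i)"
      using s' t' i unfolding integral_Simp_iff atMost_iff by blast+
    then show "snd s i = snd t i"
      by (rule sset_map_eqI) (use snd i in simp)
  qed
qed (rule fst)

lemma integral_simplicial_set: "simplicial_set (integral D X)"
proof -
  have Act_in: "Act (integral D X) m n \<theta> s \<in> Simp (integral D X) m"
    if \<theta>: "\<theta> \<in> delta_hom m n" and s: "s \<in> Simp (integral D X) n" for \<theta> m n s
  proof -
    obtain \<sigma> \<beta> where s_eq: "s = (\<sigma>, \<beta>)" by fastforce
    have \<sigma>: "\<sigma> \<in> Simp (nerve D) n"
      and \<beta>: "\<And>i. i \<le> n \<Longrightarrow> sset_map (simplex {..i}) (DOb X (FOb \<sigma> i)) (\<beta> i)"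
      and nat: "\<And>i j p h. \<lbrakk>j \<le> n; i \<le> j; h \<in> Simp (simplex {..i}) p\<rbrakk>
        \<Longrightarrow> \<beta> j p h = DAr X (FAr \<sigma> (i, j)) p (\<beta> i p h)"
      using s unfolding s_eq integral_Simp_iff by blast+
    define \<gamma> where "\<gamma> = snd (Act (integral D X) m n \<theta> (\<sigma>, \<beta>))"
    have img: "mono_on {..j} \<theta>" "\<theta> ` {..j} \<subseteq> {..\<theta> j}" if "j \<le> m" for j
      using that delta_hom_mono_on[OF \<theta>, of "{..j}"] delta_hom_mono[OF \<theta>] by auto
    have "(Act (nerve D) m n \<theta> \<sigma>, \<gamma>) \<in> Simp (integral D X) m"
      unfolding integral_Simp_iff
    proof (intro conjI allI ballI impI)
      show "Act (nerve D) m n \<theta> \<sigma> \<in> Simp (nerve D) m"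
        by (rule simplicial_set.Act_in[OF nerve_simplicial_set \<theta> \<sigma>])
      show "\<gamma> \<in> extensional {..m}" by (simp add: \<gamma>_def integral_def)
      show "sset_map (simplex {..i}) (DOb X (FOb (Act (nerve D) m n \<theta> \<sigma>) i)) (\<gamma> i)"
        if "i \<le> m" for i
        using sset_map_comp[OF sset_map_simplex_map[OF img[OF that]]
            \<beta>[OF delta_hom_le[OF \<theta> that]] simplex_simplicial_set] that
        by (simp add: \<gamma>_def integral_def)
      fix j i p h assume ij: "j \<le> m" "i \<le> j" and h: "h \<in> Simp (simplex {..i}) p"
      have im: "i \<le> m" using ij by simp
      have "h \<in> Simp (simplex {..j}) p" using Simp_simplex_mono[OF h] ij by simp
      then show "\<gamma> j p h = DAr X (FAr (Act (nerve D) m n \<theta> \<sigma>) (i, j)) p (\<gamma> i p h)"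
        using nat[OF delta_hom_le[OF \<theta> ij(1)] delta_hom_mono[OF \<theta> ij(2,1)]
            compose_in_simplex[OF h img[OF im]]] ij h im
        by (simp add: \<gamma>_def snd_Act_integral)
    qed
    then show ?thesis by (simp add: s_eq \<gamma>_def integral_def)
  qed
  show ?thesis
  proof
    fix s n assume s: "s \<in> Simp (integral D X) n"
    show "Act (integral D X) n n (\<lambda>i\<in>{..n}. i) s = s"
    proof (rule integral_eqI[OF Act_in[OF id_in_delta s] s])
      show "fst (Act (integral D X) n n (\<lambda>i\<in>{..n}. i) s) = fst s"
        unfolding fst_Act_integral
        by (rule simplicial_set.Act_id[OF nerve_simplicial_set fst_integral_in_nerve[OF s]])
      fix i p h assume i: "i \<le> n" and h: "h \<in> Simp (simplex {..i}) p"
      then have "compose {..p} (\<lambda>i\<in>{..n}. i) h = h"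
        by (auto simp: simplex_def compose_def PiE_def Pi_def extensional_def fun_eq_iff)
      then show "snd (Act (integral D X) n n (\<lambda>i\<in>{..n}. i) s) i p h = snd s i p h"
        using i h by (simp add: snd_Act_integral)
    qed simp
  next
    fix \<phi> k m \<theta> n s
    assume \<phi>: "\<phi> \<in> delta_hom k m" and \<theta>: "\<theta> \<in> delta_hom m n" and s: "s \<in> Simp (integral D X) n"
    show "Act (integral D X) k n (compose {..k} \<theta> \<phi>) s
        = Act (integral D X) k m \<phi> (Act (integral D X) m n \<theta> s)"
    proof (rule integral_eqI[OF Act_in[OF delta_hom_comp[OF \<phi> \<theta>] s] Act_in[OF \<phi> Act_in[OF \<theta> s]]])
      show "fst (Act (integral D X) k n (compose {..k} \<theta> \<phi>) s)
          = fst (Act (integral D X) k m \<phi> (Act (integral D X) m n \<theta> s))"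
        unfolding fst_Act_integral
        by (rule simplicial_set.Act_comp[OF nerve_simplicial_set \<phi> \<theta> fst_integral_in_nerve[OF s]])
      fix i p h assume i: "i \<le> k" and h: "h \<in> Simp (simplex {..i}) p"
      have "mono_on {..i} \<phi>" "\<phi> ` {..i} \<subseteq> {..\<phi> i}"
        using i delta_hom_mono_on[OF \<phi>, of "{..i}"] delta_hom_mono[OF \<phi>] by auto
      then have "compose {..p} \<phi> h \<in> Simp (simplex {..\<phi> i}) p"
        by (rule compose_in_simplex[OF h])
      moreover have "compose {..p} (compose {..k} \<theta> \<phi>) h = compose {..p} \<theta> (compose {..p} \<phi> h)"
        using h i by (auto simp: simplex_def compose_def PiE_def Pi_def fun_eq_iff)
      ultimately show "snd (Act (integral D X) k n (compose {..k} \<theta> \<phi>) s) i p h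
          = snd (Act (integral D X) k m \<phi> (Act (integral D X) m n \<theta> s)) i p h"
        using i h delta_hom_le[OF \<phi> i] by (simp add: snd_Act_integral compose_eq)
    qed
  qed (rule Act_in)
qed

lemma integral_over: "over (nerve D) (integral D X) (integral_proj D X)"
proof -
  have "sset_map (integral D X) (nerve D) (integral_proj D X)"
    using simplicial_set.Act_in[OF integral_simplicial_set, of _ _ _ _ D X]
    unfolding sset_map_def integral_proj_def
    by (auto simp: fst_Act_integral fst_integral_in_nerve)
  then show ?thesis
    by (simp add: over_def nerve_simplicial_set integral_simplicial_set)
qed

section \<open>The isomorphism\<close>

text \<open>The counterpart of \<open>integral_Simp_iff\<close>: an inclusion of posets acts on simplices as the identity.\<close>

lemma rel_nerve_Simp_iff:
  "(\<sigma>, \<tau>) \<in> Simp (rel_nerve D X) n \<longleftrightarrow>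
    \<sigma> \<in> Simp (nerve D) n \<and> \<tau> \<in> extensional (subposets n) \<and>
    (\<forall>K\<in>subposets n. sset_map (simplex K) (DOb X (FOb \<sigma> (Max K))) (\<tau> K)) \<and>
    (\<forall>K\<in>subposets n. \<forall>I\<in>subposets n. I \<subseteq> K \<longrightarrow> (\<forall>p. \<forall>h\<in>Simp (simplex I) p.
       \<tau> K p h = DAr X (FAr \<sigma> (Max I, Max K)) p (\<tau> I p h)))"
  unfolding rel_nerve_def nerve_def by (auto simp: smap_comp_eq_iff)

definition restrict_to_subposets ::
  "nat \<Rightarrow> (nat \<Rightarrow> (nat \<Rightarrow> nat, 'x) smap) \<Rightarrow> nat set \<Rightarrow> (nat \<Rightarrow> nat, 'x) smap" where
  "restrict_to_subposets n \<beta> =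
    (\<lambda>K\<in>subposets n. smap_comp (simplex K) (\<beta> (Max K)) (simplex_incl K))"

definition initial_segments ::
  "nat \<Rightarrow> (nat set \<Rightarrow> (nat \<Rightarrow> nat, 'x) smap) \<Rightarrow> nat \<Rightarrow> (nat \<Rightarrow> nat, 'x) smap" where
  "initial_segments n \<tau> = (\<lambda>i\<in>{..n}. \<tau> {..i})"

lemma restrict_to_subposets_apply:
  "\<lbrakk>K \<in> subposets n; h \<in> Simp (simplex K) p\<rbrakk>
    \<Longrightarrow> restrict_to_subposets n \<beta> K p h = \<beta> (Max K) p h"
  by (simp add: restrict_to_subposets_def)

lemma restrict_to_subposets_in:
  assumes "(\<sigma>, \<beta>) \<in> Simp (integral D X) n"
  shows "(\<sigma>, restrict_to_subposets n \<beta>) \<in> Simp (rel_nerve D X) n"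
proof -
  have \<sigma>: "\<sigma> \<in> Simp (nerve D) n"
    and \<beta>: "\<And>i. i \<le> n \<Longrightarrow> sset_map (simplex {..i}) (DOb X (FOb \<sigma> i)) (\<beta> i)"
    and nat: "\<And>i j p h. \<lbrakk>j \<le> n; i \<le> j; h \<in> Simp (simplex {..i}) p\<rbrakk>
      \<Longrightarrow> \<beta> j p h = DAr X (FAr \<sigma> (i, j)) p (\<beta> i p h)"
    using assms unfolding integral_Simp_iff by blast+
  show ?thesis
    unfolding rel_nerve_Simp_iff
  proof (intro conjI allI ballI impI)
    show "restrict_to_subposets n \<beta> \<in> extensional (subposets n)"
      by (simp add: restrict_to_subposets_def)
    fix K assume K: "K \<in> subposets n"
    have "sset_map (simplex K) (simplex {..Max K}) (simplex_incl K)"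
      using subposetsD(3)[OF K] by (intro sset_map_simplex_map) (auto simp: mono_on_def)
    from sset_map_comp[OF this \<beta>[OF subposetsD(2)[OF K]] simplex_simplicial_set]
    show "sset_map (simplex K) (DOb X (FOb \<sigma> (Max K))) (restrict_to_subposets n \<beta> K)"
      using K by (simp add: restrict_to_subposets_def)
    fix I p h assume I: "I \<in> subposets n" "I \<subseteq> K" and h: "h \<in> Simp (simplex I) p"
    have "h \<in> Simp (simplex K) p" "h \<in> Simp (simplex {..Max I}) p"
      using Simp_simplex_mono[OF h] I subposetsD(3)[OF I(1)] by blast+
    then show "restrict_to_subposets n \<beta> K p h
        = DAr X (FAr \<sigma> (Max I, Max K)) p (restrict_to_subposets n \<beta> I p h)"
      using nat[OF subposetsD(2)[OF K] Max_mono_subposets[OF K I]] K I h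
      by (simp add: restrict_to_subposets_apply)
  qed (rule \<sigma>)
qed

lemma initial_segments_in:
  assumes "(\<sigma>, \<tau>) \<in> Simp (rel_nerve D X) n"
  shows "(\<sigma>, initial_segments n \<tau>) \<in> Simp (integral D X) n"
proof -
  have \<sigma>: "\<sigma> \<in> Simp (nerve D) n"
    and \<tau>: "\<And>K. K \<in> subposets n \<Longrightarrow> sset_map (simplex K) (DOb X (FOb \<sigma> (Max K))) (\<tau> K)"
    and compat: "\<And>K I p h. \<lbrakk>K \<in> subposets n; I \<in> subposets n; I \<subseteq> K; h \<in> Simp (simplex I) p\<rbrakk>
      \<Longrightarrow> \<tau> K p h = DAr X (FAr \<sigma> (Max I, Max K)) p (\<tau> I p h)"
    using assms unfolding rel_nerve_Simp_iff by blast+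
  show ?thesis
    unfolding integral_Simp_iff
  proof (intro conjI allI ballI impI)
    show "initial_segments n \<tau> \<in> extensional {..n}" by (simp add: initial_segments_def)
    show "sset_map (simplex {..i}) (DOb X (FOb \<sigma> i)) (initial_segments n \<tau> i)" if "i \<le> n" for i
      using \<tau>[OF atMost_in_subposets[OF that]] that
      by (simp add: Max_atMost_nat initial_segments_def)
    show "initial_segments n \<tau> j p h = DAr X (FAr \<sigma> (i, j)) p (initial_segments n \<tau> i p h)"
      if "j \<le> n" "i \<le> j" "h \<in> Simp (simplex {..i}) p" for j i p h
      using compat[OF atMost_in_subposets atMost_in_subposets, of j i h p] that
      by (simp add: Max_atMost_nat initial_segments_def)
  qed (rule \<sigma>)
qed

lemma initial_segments_restrict:
  assumes "(\<sigma>, \<beta>) \<in> Simp (integral D X) n"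
  shows "(\<sigma>, initial_segments n (restrict_to_subposets n \<beta>)) = (\<sigma>, \<beta>)"
proof (rule integral_eqI[OF initial_segments_in[OF restrict_to_subposets_in[OF assms]] assms])
  show "snd (\<sigma>, initial_segments n (restrict_to_subposets n \<beta>)) i p h = snd (\<sigma>, \<beta>) i p h"
    if "i \<le> n" "h \<in> Simp (simplex {..i}) p" for i p h
    using that restrict_to_subposets_apply[OF atMost_in_subposets, of i n h p \<beta>]
    by (simp add: initial_segments_def Max_atMost_nat)
qed simp

text \<open>
  The compatibility condition for \<open>K \<subseteq> {..Max K}\<close> involves \<open>X\<close> only at an identity arrow, because
  both posets have the same maximum.  This is why initial segments determine the whole family.
\<close>

lemma rel_nerve_component:
  assumes X: "sset_functor D X" and s: "(\<sigma>, \<tau>) \<in> Simp (rel_nerve D X) n"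
    and K: "K \<in> subposets n" and h: "h \<in> Simp (simplex K) p"
  shows "\<tau> K p h = \<tau> {..Max K} p h"
proof -
  let ?k = "Max K"
  have k: "?k \<le> n" and sub: "K \<subseteq> {..?k}" using subposetsD[OF K] by blast+
  have \<sigma>: "\<sigma> \<in> Simp (nerve D) n" and \<tau>: "sset_map (simplex K) (DOb X (FOb \<sigma> ?k)) (\<tau> K)"
    using s K unfolding rel_nerve_Simp_iff by blast+
  have ob: "FOb \<sigma> ?k \<in> Ob D" by (rule nerve_Ob[OF \<sigma> k])
  have "FAr \<sigma> (?k, ?k) = Idt D (FOb \<sigma> ?k)"
    using \<sigma> k by (auto simp: nerve_def is_functor_def ordinal_def)
  then have "DAr X (FAr \<sigma> (?k, ?k)) = smap_id (DOb X (FOb \<sigma> ?k))"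
    using X ob by (simp add: sset_functor_def)
  moreover have "\<tau> {..?k} p h = DAr X (FAr \<sigma> (?k, Max {..?k})) p (\<tau> K p h)"
    using s K h sub atMost_in_subposets[OF k] Max_atMost_nat unfolding rel_nerve_Simp_iff
    by blast
  ultimately show ?thesis
    using sset_map_in[OF \<tau> h] by (simp add: Max_atMost_nat smap_id_def)
qed

lemma restrict_initial_segments:
  assumes X: "sset_functor D X" and s: "(\<sigma>, \<tau>) \<in> Simp (rel_nerve D X) n"
  shows "restrict_to_subposets n (initial_segments n \<tau>) = \<tau>"
proof (rule extensionalityI[where A = "subposets n"])
  show "restrict_to_subposets n (initial_segments n \<tau>) \<in> extensional (subposets n)"
    by (simp add: restrict_to_subposets_def)
  show "\<tau> \<in> extensional (subposets n)" using s by (simp add: rel_nerve_Simp_iff)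
  have s': "(\<sigma>, restrict_to_subposets n (initial_segments n \<tau>)) \<in> Simp (rel_nerve D X) n"
    by (rule restrict_to_subposets_in[OF initial_segments_in[OF s]])
  fix K assume K: "K \<in> subposets n"
  show "restrict_to_subposets n (initial_segments n \<tau>) K = \<tau> K"
  proof (rule sset_map_eqI)
    show "sset_map (simplex K) (DOb X (FOb \<sigma> (Max K)))
        (restrict_to_subposets n (initial_segments n \<tau>) K)"
      "sset_map (simplex K) (DOb X (FOb \<sigma> (Max K))) (\<tau> K)"
      using s s' K by (simp_all add: rel_nerve_Simp_iff)
    show "restrict_to_subposets n (initial_segments n \<tau>) K p h = \<tau> K p h"
      if h: "h \<in> Simp (simplex K) p" for p h
      using rel_nerve_component[OF X s K h] subposetsD(2)[OF K]
      by (simp add: restrict_to_subposets_apply[OF K h] initial_segments_def)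
  qed
qed

text \<open>
  At a simplex \<open>h\<close> of \<open>\<Delta>\<^sup>K\<close> the left side evaluates \<open>\<beta> (\<theta> (Max K))\<close> and the right side
  \<open>\<beta> (Max (\<theta> ` K))\<close>, both at \<open>\<theta> \<circ> h\<close>.
\<close>

lemma restrict_to_subposets_Act:
  assumes \<theta>: "\<theta> \<in> delta_hom m n"
  shows "restrict_to_subposets m (snd (Act (integral D X) m n \<theta> (\<sigma>, \<beta>)))
    = snd (Act (rel_nerve D X) m n \<theta> (\<sigma>, restrict_to_subposets n \<beta>))"
proof (rule extensionalityI[where A = "subposets m"])
  show "restrict_to_subposets m (snd (Act (integral D X) m n \<theta> (\<sigma>, \<beta>))) \<in> extensional (subposets m)"
    by (simp add: restrict_to_subposets_def)
  show "snd (Act (rel_nerve D X) m n \<theta> (\<sigma>, restrict_to_subposets n \<beta>)) \<in> extensional (subposets m)"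
    by (simp add: rel_nerve_def)
  fix K assume K: "K \<in> subposets m"
  have "mono_on K \<theta>" using delta_hom_mono_on[OF \<theta>] K by (simp add: subposets_def)
  then have "compose {..p} \<theta> h \<in> Simp (simplex (\<theta> ` K)) p" if "h \<in> Simp (simplex K) p" for p h
    using compose_in_simplex[OF that] by blast
  moreover have "h \<in> Simp (simplex {..Max K}) p" if "h \<in> Simp (simplex K) p" for p h
    by (rule Simp_simplex_mono[OF that subposetsD(3)[OF K]])
  ultimately show "restrict_to_subposets m (snd (Act (integral D X) m n \<theta> (\<sigma>, \<beta>))) K
      = snd (Act (rel_nerve D X) m n \<theta> (\<sigma>, restrict_to_subposets n \<beta>)) K"
    using K subposetsD(2)[OF K] image_in_subposets[OF \<theta> K] Max_image_delta[OF \<theta> K]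
    by (simp add: rel_nerve_def restrict_to_subposets_def[of m] smap_comp_eq_iff
        snd_Act_integral simplex_map_apply restrict_to_subposets_apply)
qed

theorem lemmaC3:
  fixes D :: "('o, 'm) cat" and X :: "('o, 'm, 'x) sset_diagram"
  assumes "category D" and "sset_functor D X"
  shows "iso_over (nerve D) (integral D X) (integral_proj D X) (rel_nerve D X) (rel_nerve_proj D X)"
proof -
  define f where "f n = (\<lambda>(\<sigma>, \<beta>)\<in>Simp (integral D X) n. (\<sigma>, restrict_to_subposets n \<beta>))" for n
  show ?thesis
  proof (rule iso_over_bijI[where f = f, OF integral_over])
    show "f n \<in> extensional (Simp (integral D X) n)" for n by (simp add: f_def)
    show "bij_betw (f n) (Simp (integral D X) n) (Simp (rel_nerve D X) n)" for n
    proof (rule bij_betw_byWitness[where f' = "\<lambda>(\<sigma>, \<tau>). (\<sigma>, initial_segments n \<tau>)"])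
      show "\<forall>s\<in>Simp (integral D X) n. (case f n s of (\<sigma>, \<tau>) \<Rightarrow> (\<sigma>, initial_segments n \<tau>)) = s"
        using initial_segments_restrict by (fastforce simp: f_def)
      show "\<forall>s\<in>Simp (rel_nerve D X) n. f n (case s of (\<sigma>, \<tau>) \<Rightarrow> (\<sigma>, initial_segments n \<tau>)) = s"
        using initial_segments_in restrict_initial_segments[OF assms(2)]
        by (fastforce simp: f_def)
      show "f n ` Simp (integral D X) n \<subseteq> Simp (rel_nerve D X) n"
        using restrict_to_subposets_in by (fastforce simp: f_def)
      show "(\<lambda>(\<sigma>, \<tau>). (\<sigma>, initial_segments n \<tau>)) ` Simp (rel_nerve D X) n \<subseteq> Simp (integral D X) n"
        using initial_segments_in by fastforce
    qed
    show "f m (Act (integral D X) m n \<theta> s) = Act (rel_nerve D X) m n \<theta> (f n s)"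
      if "\<theta> \<in> delta_hom m n" "s \<in> Simp (integral D X) n" for m n \<theta> s
      using simplicial_set.Act_in[OF integral_simplicial_set that] that(2)
        restrict_to_subposets_Act[OF that(1), of D X "fst s" "snd s"]
      by (simp add: f_def split_beta prod_eq_iff) (simp add: integral_def rel_nerve_def split_beta)
    show "rel_nerve_proj D X n \<in> extensional (Simp (rel_nerve D X) n)" for n
      by (simp add: rel_nerve_proj_def)
    show "rel_nerve_proj D X n (f n s) = integral_proj D X n s"
      if "s \<in> Simp (integral D X) n" for n s
      using that restrict_to_subposets_in[of "fst s" "snd s" D X n]
      by (simp add: f_def rel_nerve_proj_def integral_proj_def split_beta)
  qed
qed

end
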